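(* Let $m\ge1$ be an integer, let $A\in\mathbb{C}^{n\times n}$ and $B\in\mathbb{C}^{d\times d}$, and let $s$ be a nonnegative integer such that $2^{-s}A\in\Omega^{(n)}_m$ and $2^{-s}B\in\Omega^{(d)}_m$. Let $E\in\mathbb{C}^{n\times d}$ be nonzero. Then the backward error $\Delta E=\mathcal{D}_{g_{2m+1}}(2^{-s}A,2^{-s}B,E)$ satisfies $$\frac{\|\Delta E\|}{\|E\|}\le \widetilde{g}_{2m+1}'\bigl(2^{-s}\max(\|A\|,\|B\|)\bigr)$$ for any subordinate matrix norm, where the sets $\Omega_m^{(n)}$, $\Omega_m^{(d)}$, the functions $g_{2m+1}$ and $\widetilde g_{2m+1}$, and the operator $\mathcal{D}_{g_{2m+1}}$ are as defined in the context.
   Context: Padé approximants. $r_m(z)=p_m(z)/q_m(z)$ denotes the diagonal $[m/m]$ Padé approximant to $\mathrm{e}^z$, i.e. $p_m(z)=\sum_{j=0}^m\frac{(2m-j)!\,m!}{(2m)!\,(m-j)!\,j!}z^j$ and $q_m(z)=p_m(-z)$. The set $\Omega_m^{(n)}$. With $\rho$ the spectral radius and $\mu_m=\min\{|z|: q_m(z)=0\}$, $$\Omega^{(n)}_m=\{Z\in\mathbb{C}^{n\times n}:\ \rho(\mathrm{e}^{-Z}r_m(Z)-I)<1,\ \rho(Z)<\mu_m\}.$$ The functions $g_{2m+1}$ and $\widetilde g_{2m+1}$. For $X\in\Omega_m^{(n)}$ (any size $n$), $g_{2m+1}(X)=\log(\mathrm{e}^{-X}r_m(X))$, where $\log$ is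 the principal matrix logarithm. Over $\Omega_m^{(n)}$ the function has the power series expansion $$g_{2m+1}(X)=\sum_{k=0}^\infty b_{m,k}X^{2(m+k)+1},$$ where the $b_{m,k}$ are the corresponding Taylor coefficients at $0$ of $\log(\mathrm{e}^{-z}r_m(z))$; as a scalar function, $g_{2m+1}$ is the sum of this power series, which is analytic on the disc $|z|<\mu_m$. Define $$\widetilde g_{2m+1}(z)=\sum_{k=0}^\infty|b_{m,k}|\,z^{2(m+k)+1},\qquad \widetilde g_{2m+1}'(z)=\sum_{k=0}^\infty(2(m+k)+1)\,|b_{m,k}|\,z^{2(m+k)},$$ where for real $z\ge0$ a divergent series is given the value $+\infty$. The operator $\mathcal{D}_f$. For $f$ analytic on a simply connected open set $\Omega\subset\mathbb{C}$ containing the spectra of $A\in\mathbb{C}^{n\times n}$ and $B\in\mathbb{C}^{d\times d}$, and $E\in\mathbb{C}^{n\times d}$, $$\mathcal{D}_f(A,B,E)=\frac{1}{2\pi \mathrm{i}}\int_\Gamma f(z)(zI_n-A)^{-1}E(zI_d-B)^{-1}\,\mathrm{d}z,$$ where $\Gamma\subset\Omega$ is a simple closed rectifiable contour strictly enclosing the union of the spectra of $A$ and $B$ and winding once around it counterclockwise. Equivalently, $\mathcal{D}_f(A,B,E)$ is the $(1,2)$ block of $f\left(\begin{bmatrix}A&E\\0&B\end{bmatrix}\right)$. Norms. A subordinate matrix norm means the operator norms induced by vector norms: given vector norms on $\mathbb{C}^n$ and $\mathbb{C}^d$ (for instance the same $p$-norm on both), $\|A\|$, $\|B\|$ and $\|E\|$,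 $\|\Delta E\|$ are the induced operator norms on $\mathbb{C}^n\to\mathbb{C}^n$, $\mathbb{C}^d\to\mathbb{C}^d$ and $\mathbb{C}^d\to\mathbb{C}^n$, respectively. *)

theory Defs
  imports "HOL-Complex_Analysis.Complex_Analysis"
begin

section \<open>Matrices\<close>

text \<open>
  On \<open>'a ^ 'n ^ 'n\<close> the library operations \<open>*\<close>, \<open>1\<close> and \<open>^\<close> act componentwise. The matrix
  product is \<open>**\<close>, the identity is \<open>mat 1\<close>, and powers have to be defined.
\<close>

primrec mat_pow :: "complex ^ 'n ^ 'n \<Rightarrow> nat \<Rightarrow> complex ^ 'n ^ 'n" where
  "mat_pow A 0 = mat 1"
| "mat_pow A (Suc k) = A ** mat_pow A k"

definition mat_exp :: "complex ^ 'n ^ 'n \<Rightarrow> complex ^ 'n ^ 'n" where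
  "mat_exp A = (\<Sum>k. (1 / fact k) *\<^sub>R mat_pow A k)"

definition mat_spectrum :: "complex ^ 'n ^ 'n \<Rightarrow> complex set" where
  "mat_spectrum A = {l. \<exists>v. v \<noteq> 0 \<and> A *v v = l *s v}"

definition spec_radius :: "complex ^ 'n ^ 'n \<Rightarrow> real" where
  "spec_radius A = Max (cmod ` mat_spectrum A)"

definition is_vector_norm :: "(complex ^ 'n \<Rightarrow> real) \<Rightarrow> bool" where
  "is_vector_norm N \<longleftrightarrow>
     (\<forall>x. N x \<ge> 0) \<and> (\<forall>x. N x = 0 \<longleftrightarrow> x = 0) \<and>
     (\<forall>c x. N (c *s x) = cmod c * N x) \<and> (\<forall>x y. N (x + y) \<le> N x + N y)"

text \<open>
  Operator norm of \<open>M\<close> from the space normed by \<open>N1\<close> to the one normed by \<open>N2\<close>; as in the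
  library's \<open>onorm\<close>, the vector \<open>0\<close> contributes the value \<open>0 / 0 = 0\<close>.
\<close>

definition induced_norm ::
    "(complex ^ 'd \<Rightarrow> real) \<Rightarrow> (complex ^ 'n \<Rightarrow> real) \<Rightarrow> complex ^ 'd ^ 'n \<Rightarrow> real" where
  "induced_norm N1 N2 M = (SUP x. N2 (M *v x) / N1 x)"


section \<open>Diagonal Pade approximants to the exponential\<close>

definition pade_coeff :: "nat \<Rightarrow> nat \<Rightarrow> real" where
  "pade_coeff m j = (fact (2 * m - j) * fact m) / (fact (2 * m) * fact (m - j) * fact j)"

definition pade_p :: "nat \<Rightarrow> complex \<Rightarrow> complex" where
  "pade_p m z = (\<Sum>j\<le>m. of_real (pade_coeff m j) * z ^ j)"

definition pade_q :: "nat \<Rightarrow> complex \<Rightarrow> complex" where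
  "pade_q m z = pade_p m (- z)"

definition pade_r :: "nat \<Rightarrow> complex \<Rightarrow> complex" where
  "pade_r m z = pade_p m z / pade_q m z"

definition pade_p_mat :: "nat \<Rightarrow> complex ^ 'n ^ 'n \<Rightarrow> complex ^ 'n ^ 'n" where
  "pade_p_mat m Z = (\<Sum>j\<le>m. pade_coeff m j *\<^sub>R mat_pow Z j)"

definition pade_q_mat :: "nat \<Rightarrow> complex ^ 'n ^ 'n \<Rightarrow> complex ^ 'n ^ 'n" where
  "pade_q_mat m Z = pade_p_mat m (- Z)"

definition pade_r_mat :: "nat \<Rightarrow> complex ^ 'n ^ 'n \<Rightarrow> complex ^ 'n ^ 'n" where
  "pade_r_mat m Z = pade_p_mat m Z ** matrix_inv (pade_q_mat m Z)"

definition pade_mu :: "nat \<Rightarrow> real" where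
  "pade_mu m = Min {cmod z | z. pade_q m z = 0}"

text \<open>
  The second condition makes \<open>pade_q_mat m Z\<close> invertible, so \<open>matrix_inv\<close> in
  \<open>pade_r_mat\<close> is a genuine inverse on this set.
\<close>

definition Omega :: "nat \<Rightarrow> (complex ^ 'n ^ 'n) set" where
  "Omega m = {Z. spec_radius (mat_exp (- Z) ** pade_r_mat m Z - mat 1) < 1 \<and>
                 spec_radius Z < pade_mu m}"


section \<open>The functions g and (g tilde)'\<close>

definition b_coeff :: "nat \<Rightarrow> nat \<Rightarrow> complex" where
  "b_coeff m k =
     (deriv ^^ (2 * (m + k) + 1)) (\<lambda>z. Ln (exp (- z) * pade_r m z)) 0 / fact (2 * (m + k) + 1)"

definition g_fun :: "nat \<Rightarrow> complex \<Rightarrow> complex" where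
  "g_fun m z = (\<Sum>k. b_coeff m k * z ^ (2 * (m + k) + 1))"

text \<open>Valued in \<open>ennreal\<close>, so that the sum is \<open>\<infinity>\<close> exactly where the series diverges.\<close>

definition g_tilde_deriv :: "nat \<Rightarrow> real \<Rightarrow> ennreal" where
  "g_tilde_deriv m x =
     (\<Sum>k. ennreal (real (2 * (m + k) + 1) * cmod (b_coeff m k) * x ^ (2 * (m + k))))"


section \<open>The operator D\<close>

text \<open>
  Rectifiable contours are rendered by the library's \<open>valid_path\<close> (piecewise continuously
  differentiable), the class of paths that \<open>contour_integral\<close> is designed for.
\<close>

definition encloses_once :: "complex set \<Rightarrow> complex set \<Rightarrow> (real \<Rightarrow> complex) \<Rightarrow> bool" where
  "encloses_once \<Omega> S \<Gamma> \<longleftrightarrow>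
     valid_path \<Gamma> \<and> simple_path \<Gamma> \<and> pathfinish \<Gamma> = pathstart \<Gamma> \<and> path_image \<Gamma> \<subseteq> \<Omega> \<and>
     S \<subseteq> inside (path_image \<Gamma>) \<and> (\<forall>z\<in>S. winding_number \<Gamma> z = 1)"

definition resolvent_integral ::
    "(real \<Rightarrow> complex) \<Rightarrow> (complex \<Rightarrow> complex) \<Rightarrow> complex ^ 'n ^ 'n \<Rightarrow> complex ^ 'd ^ 'd \<Rightarrow>
     complex ^ 'd ^ 'n \<Rightarrow> complex ^ 'd ^ 'n" where
  "resolvent_integral \<Gamma> f A B E =
     (\<chi> i j. 1 / (2 * of_real pi * \<i>) *
        contour_integral \<Gamma>
          (\<lambda>z. f z * (matrix_inv (mat z - A) ** E ** matrix_inv (mat z - B)) $ i $ j))"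

text \<open>
  For \<open>f\<close> holomorphic on a simply connected open \<open>\<Omega>\<close> containing both spectra, the integral is
  the same for every admissible contour (residue theorem), so the choice below is immaterial.
\<close>

definition D_op ::
    "(complex \<Rightarrow> complex) \<Rightarrow> complex set \<Rightarrow> complex ^ 'n ^ 'n \<Rightarrow> complex ^ 'd ^ 'd \<Rightarrow>
     complex ^ 'd ^ 'n \<Rightarrow> complex ^ 'd ^ 'n" where
  "D_op f \<Omega> A B E =
     resolvent_integral (SOME \<Gamma>. encloses_once \<Omega> (mat_spectrum A \<union> mat_spectrum B) \<Gamma>) f A B E"

end

theory Submission
  imports Defs
begin

text \<open>
  On the disc \<open>\<bar>z\<bar> < \<mu>\<^sub>m\<close>, which contains the spectra, the function
  \<open>exp (- z) r\<^sub>m(z)\<close> has no zeros and no poles, so it has a holomorphic logarithm there and the power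
  series of \<open>g\<close> converges on the whole disc. By the residue theorem the contour of the resolvent
  integral can be replaced by a circle around \<open>0\<close> inside the disc, where the power series may be
  integrated term by term. The integral of \<open>z^k (z - A)\<inverse> E (z - B)\<inverse>\<close> satisfies a recurrence in \<open>k\<close>
  (from \<open>z (z - A)\<inverse> = 1 + A (z - A)\<inverse>\<close>) and vanishes for \<open>k = 0\<close> because the integrand decays
  quadratically; it is \<open>2 \<pi> i\<close> times the sum of \<open>A^p E B^q\<close> over \<open>p + q = k - 1\<close>, of norm at most
  \<open>k \<parallel>E\<parallel> max(\<parallel>A\<parallel>, \<parallel>B\<parallel>)^(k - 1)\<close>. Summing over the power series gives the bound.
\<close>

text \<open>Throughout, \<open>$\<close> selects a component of a vector or matrix; its competing
  reading as a power series coefficient is dropped.\<close>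

no_notation fps_nth (infixl \<open>$\<close> 75)


section \<open>Matrices and resolvents\<close>

lemma norm_vector_smult: "norm (c *s x) = cmod c * norm x" for x :: "complex ^ 'n"
  by (simp add: norm_vec_def L2_set_def norm_mult power_mult_distrib
      flip: sum_distrib_left) (simp add: real_sqrt_mult)

lemma mat_component: "(mat c :: 'a::zero ^ 'n ^ 'n) $ i $ j = (if i = j then c else 0)"
  by (simp add: mat_def)

lemma mat_mult_component: "(mat c ** M) $ i $ j = c * M $ i $ j" for c :: complex
  by (simp add: matrix_matrix_mult_def mat_def if_distrib if_distribR sum.delta cong: if_cong)

lemma mat_mult_vector: "mat c *v x = c *s x" for c :: complex
  by (simp add: matrix_vector_mult_def mat_def vec_eq_iff if_distrib if_distribR sum.delta cong: if_cong)

lemma matrix_add_rdistrib: "(A + B) ** C = A ** C + B ** C"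
  by (simp add: matrix_matrix_mult_def vec_eq_iff sum.distrib distrib_right)

text \<open>Scalars are carried as matrices \<open>mat c\<close>. The two occurrences here have
  different sizes, so a scalar can be pulled through a rectangular \<open>M\<close>.\<close>

lemma mult_mat_commute: "M ** (mat c ** N) = mat c ** (M ** N)"
  for M :: "complex ^ 'b ^ 'a" and N :: "complex ^ 'c ^ 'b"
proof -
  have "(\<Sum>k\<in>UNIV. M $ i $ k * (mat c ** N) $ k $ j) = c * (\<Sum>k\<in>UNIV. M $ i $ k * N $ k $ j)" for i j
    by (simp add: mat_mult_component sum_distrib_left mult.left_commute)
  then have "(M ** (mat c ** N)) $ i $ j = c * (M ** N) $ i $ j" for i j
    \<comment> \<open>Only the outer products are unfolded; the inner \<open>mat c ** N\<close> must
      keep the form in which the previous equation mentions it.\<close>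
    by (subst (1 3) matrix_matrix_mult_def) simp
  then show ?thesis
    by (simp add: vec_eq_iff mat_mult_component)
qed

lemma matrix_vector_bound:
  fixes A :: "complex ^ 'n ^ 'm"
  obtains K where "K > 0" "\<And>x. norm (A *v x) \<le> K * norm x"
proof -
  have "bounded_linear ((*v) A)"
    by (rule matrix_vector_mul_bounded_linear)
  then obtain K where "K > 0" "\<And>x. norm (A *v x) \<le> norm x * K"
    using bounded_linear.pos_bounded by blast
  then show ?thesis
    by (auto intro!: that[of K] simp: mult.commute)
qed

text \<open>Entry \<open>(i, j)\<close> is a component of the image of the \<open>j\<close>-th basis
  vector. This turns bounds on matrix-vector products into bounds on the scalar integrands.\<close>

lemma norm_entry_le: "cmod (M $ i $ j) \<le> norm (M *v axis j 1)" for M :: "complex ^ 'n ^ 'm"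
proof -
  have "(M *v axis j 1) $ i = M $ i $ j"
    by (simp add: matrix_vector_mult_def axis_def if_distrib if_distribR sum.delta cong: if_cong)
  then show ?thesis
    using Finite_Cartesian_Product.norm_nth_le[of "M *v axis j 1" i] by simp
qed

section \<open>Resolvents and the spectrum\<close>

abbreviation resolvent :: "complex ^ 'n ^ 'n \<Rightarrow> complex \<Rightarrow> complex ^ 'n ^ 'n" where
  "resolvent A z \<equiv> matrix_inv (mat z - A)"

lemma matrix_inv_right:
  fixes M :: "'a::semiring_1 ^ 'n ^ 'm"
  assumes "invertible M"
  shows "M ** matrix_inv M = mat 1"
  using assms someI_ex[of "\<lambda>N. M ** N = mat 1 \<and> N ** M = mat 1"]
  unfolding invertible_def matrix_inv_def by blast

lemma invertible_iff_not_spectrum: "invertible (mat z - A) \<longleftrightarrow> z \<notin> mat_spectrum A"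
  unfolding invertible_left_inverse matrix_left_invertible_ker
  by (auto simp: mat_spectrum_def matrix_vector_mult_diff_rdistrib mat_mult_vector)

lemma resolvent_right:
  assumes "z \<notin> mat_spectrum A"
  shows "(mat z - A) ** resolvent A z = mat 1"
  using assms invertible_iff_not_spectrum matrix_inv_right by blast

text \<open>Split \<open>mat z\<close> as \<open>(mat z - M) + M\<close>. Each use trades a factor
  \<open>z\<close> for a factor \<open>M\<close> plus a term without resolvent, which drives the
  inductions over powers of \<open>z\<close>.\<close>

lemma resolvent_recurrence:
  fixes M :: "complex ^ 'k ^ 'k"
  assumes "z \<notin> mat_spectrum M"
  shows "mat z ** resolvent M z = mat 1 + M ** resolvent M z"
proof -
  have "mat z ** resolvent M z = ((mat z - M) + M) ** resolvent M z"
    by simp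
  then show ?thesis
    using resolvent_right[OF assms] by (simp only: matrix_add_rdistrib)
qed

text \<open>Cramer's rule for the system with right-hand side \<open>axis j 1\<close>, whose
  solution is the \<open>j\<close>-th column of the inverse.\<close>

lemma matrix_inv_entry:
  fixes M :: "complex ^ 'n ^ 'n"
  assumes "invertible M"
  shows "matrix_inv M $ i $ j = det (\<chi> k l. if l = i then axis j 1 $ k else M $ k $ l) / det M"
proof -
  have "M *v (matrix_inv M *v axis j 1) = axis j 1"
    by (simp add: matrix_vector_mul_assoc matrix_inv_right[OF assms])
  moreover have det: "det M \<noteq> 0"
    using assms invertible_det_nz by blast
  ultimately have "matrix_inv M *v axis j 1
      = (\<chi> i. det (\<chi> k l. if l = i then axis j 1 $ k else M $ k $ l) / det M)"
    by (intro iffD1[OF cramer])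
  then have "(matrix_inv M *v axis j 1) $ i
      = det (\<chi> k l. if l = i then axis j 1 $ k else M $ k $ l) / det M"
    by simp
  moreover have "(matrix_inv M *v axis j 1) $ i = matrix_inv M $ i $ j"
    by (simp add: matrix_vector_mult_def axis_def if_distrib if_distribR sum.delta cong: if_cong)
  ultimately show ?thesis by simp
qed

lemma holomorphic_on_det:
  fixes M :: "complex \<Rightarrow> complex ^ 'n ^ 'n"
  assumes "\<And>i j. (\<lambda>z. M z $ i $ j) holomorphic_on S"
  shows "(\<lambda>z. det (M z)) holomorphic_on S"
  unfolding det_def by (intro holomorphic_intros assms)

text \<open>By Cramer's rule an entry is a quotient of determinants that are polynomial in
  \<open>z\<close>, and the denominator vanishes exactly on the spectrum.\<close>

lemma holomorphic_on_resolvent_entry: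
  "(\<lambda>z. resolvent A z $ i $ j) holomorphic_on - mat_spectrum A"
proof -
  have entry: "(\<lambda>z. (mat z - A) $ k $ l) holomorphic_on - mat_spectrum A" for k l
    by (cases "k = l") (auto simp: mat_component intro!: holomorphic_intros)
  have "(\<lambda>z. det (\<chi> k l. if l = i then axis j 1 $ k else (mat z - A) $ k $ l) / det (mat z - A))
      holomorphic_on - mat_spectrum A"
  proof (intro holomorphic_on_divide holomorphic_on_det)
    show "(\<lambda>z. (\<chi> k l. if l = i then axis j 1 $ k else (mat z - A) $ k $ l) $ k $ l)
        holomorphic_on - mat_spectrum A" for k l
      using entry[of k l] by (cases "l = i") (auto intro!: holomorphic_intros)
    show "det (mat z - A) \<noteq> 0" if "z \<in> - mat_spectrum A" for z
      using that by (simp add: invertible_iff_not_spectrum flip: invertible_det_nz)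
  qed (fact entry)
  then show ?thesis
  proof (rule holomorphic_transform)
    show "det (\<chi> k l. if l = i then axis j 1 $ k else (mat z - A) $ k $ l) / det (mat z - A)
        = resolvent A z $ i $ j" if "z \<in> - mat_spectrum A" for z
      using that matrix_inv_entry[of "mat z - A"] by (simp add: invertible_iff_not_spectrum)
  qed
qed

text \<open>Let \<open>K\<close> bound \<open>A\<close> and take \<open>R = 2 * K\<close>. For
  \<open>y = resolvent A z *v x\<close> one has \<open>z y = x + A y\<close>; as \<open>K\<close> is
  at most half of \<open>cmod z\<close>, the term \<open>A y\<close> can be absorbed on the left.
  The same comparison excludes eigenvalues of modulus at least \<open>R\<close>.\<close>

lemma resolvent_bound:
  fixes A :: "complex ^ 'n ^ 'n"
  obtains R where "R > 0"
    "\<And>z. cmod z \<ge> R \<Longrightarrow> z \<notin> mat_spectrum A"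
    "\<And>z x. cmod z \<ge> R \<Longrightarrow> norm (resolvent A z *v x) \<le> 2 / cmod z * norm x"
proof -
  obtain K where K: "K > 0" "\<And>x. norm (A *v x) \<le> K * norm x"
    using matrix_vector_bound[of A] by metis
  have nspec: "z \<notin> mat_spectrum A" if "cmod z \<ge> 2 * K" for z
  proof
    assume "z \<in> mat_spectrum A"
    then obtain v where v: "v \<noteq> 0" "A *v v = z *s v"
      by (auto simp: mat_spectrum_def)
    then have "cmod z * norm v \<le> K * norm v"
      using K(2)[of v] by (simp add: norm_vector_smult)
    then show False
      using v(1) that K(1) by simp
  qed
  show ?thesis
  proof
    show "norm (resolvent A z *v x) \<le> 2 / cmod z * norm x" if z: "cmod z \<ge> 2 * K" for z x
    proof -
      define y where "y = resolvent A z *v x"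
      have "(mat z - A) *v y = x"
        by (simp add: y_def matrix_vector_mul_assoc resolvent_right[OF nspec[OF z]])
      then have "z *s y = x + A *v y"
        by (simp add: matrix_vector_mult_diff_rdistrib mat_mult_vector algebra_simps)
      then have "cmod z * norm y \<le> norm x + K * norm y"
        using norm_triangle_ineq[of x "A *v y"] K(2)[of y] norm_vector_smult[of z y] by simp
      also have "K * norm y \<le> cmod z / 2 * norm y"
        using z by (intro mult_right_mono) auto
      finally have "cmod z * norm y \<le> 2 * norm x" by simp
      moreover have "cmod z > 0" using z K(1) by linarith
      ultimately show ?thesis
        by (simp add: y_def field_simps)
    qed
  next
    show "2 * K > 0" using K(1) by simp
  qed (fact nspec)
qed

lemma finite_mat_spectrum: "finite (mat_spectrum A)"
proof -
  \<comment> \<open>The characteristic polynomial, as the determinant of a matrix of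
    polynomials.\<close>
  define P :: "complex poly" where "P = det (\<chi> i j. if i = j then [:- (A $ i $ j), 1:] else [:- (A $ i $ j):])"
  have P: "poly P z = det (mat z - A)" for z
    unfolding P_def det_def
    by (auto simp: poly_sum poly_prod mat_component if_distrib intro!: sum.cong prod.cong)
  obtain R where "R > 0" and R: "\<And>z. cmod z \<ge> R \<Longrightarrow> z \<notin> mat_spectrum A"
    by (rule resolvent_bound[of A]) (rule that)
  \<comment> \<open>A point that is not an eigenvalue shows that \<open>P\<close> is not the zero
    polynomial.\<close>
  then have "of_real R \<notin> mat_spectrum A"
    by simp
  then have "poly P (of_real R) \<noteq> 0"
    by (simp add: P invertible_iff_not_spectrum flip: invertible_det_nz)
  then have "finite {z. poly P z = 0}"
    by (intro poly_roots_finite) auto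
  moreover have "mat_spectrum A = {z. poly P z = 0}"
    using invertible_iff_not_spectrum invertible_det_nz unfolding P by blast
  ultimately show ?thesis by simp
qed

text \<open>The spectral radius is a \<open>Max\<close>, which bounds the eigenvalues because there
  are finitely many.\<close>

lemma mat_spectrum_subset_cball: "mat_spectrum A \<subseteq> cball 0 (spec_radius A)"
  unfolding spec_radius_def using finite_mat_spectrum[of A] by auto


section \<open>Contour integrals of resolvents\<close>

text \<open>By the residue theorem both integrals are the same combination of residues, weighted by
  winding numbers. The nature of the singularities in \<open>P\<close> does not matter, only that
  they are isolated.\<close>

lemma contour_integral_eq_same_winding:
  assumes "open S" "convex S" "finite P" "f holomorphic_on S - P"
    and "valid_path \<gamma>" "pathfinish \<gamma> = pathstart \<gamma>" "path_image \<gamma> \<subseteq> S - P"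
    and "valid_path \<delta>" "pathfinish \<delta> = pathstart \<delta>" "path_image \<delta> \<subseteq> S - P"
    and "\<And>p. p \<in> P \<Longrightarrow> winding_number \<gamma> p = winding_number \<delta> p"
  shows "contour_integral \<gamma> f = contour_integral \<delta> f"
proof -
  have res: "contour_integral \<eta> f = 2 * pi * \<i> * (\<Sum>p\<in>P. winding_number \<eta> p * residue f p)"
    if "valid_path \<eta>" "pathfinish \<eta> = pathstart \<eta>" "path_image \<eta> \<subseteq> S - P" for \<eta>
  proof (rule Residue_theorem[of S])
    \<comment> \<open>A closed path in a convex set does not wind around any point outside that
      set.\<close>
    show "\<forall>z. z \<notin> S \<longrightarrow> winding_number \<eta> z = 0"
      using that assms(2) by (blast intro: winding_number_zero_outside valid_path_imp_path)
  qed (use assms that convex_connected in auto)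
  show ?thesis
    using assms by (simp add: res)
qed

lemma contour_integral_circlepath_eq:
  assumes "open S" "convex S" "finite P" "f holomorphic_on S - P"
    and "valid_path \<gamma>" "pathfinish \<gamma> = pathstart \<gamma>" "path_image \<gamma> \<subseteq> S - P"
    and "\<And>p. p \<in> P \<Longrightarrow> winding_number \<gamma> p = 1"
    and "r > 0" "P \<subseteq> ball 0 r" "cball 0 r \<subseteq> S"
  shows "contour_integral \<gamma> f = contour_integral (circlepath 0 r) f"
proof (rule contour_integral_eq_same_winding[OF assms(1-7)])
  show "path_image (circlepath 0 r) \<subseteq> S - P"
  proof
    fix z assume "z \<in> path_image (circlepath 0 r)"
    then have "cmod z = r"
      using assms(9) by auto
    then show "z \<in> S - P"
      using assms(10,11) by auto
  qed
  show "winding_number \<gamma> p = winding_number (circlepath 0 r) p" if "p \<in> P" for p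
  proof -
    have "cmod (p - 0) < r"
      using that assms(10) by auto
    then show ?thesis
      using assms(8)[OF that] winding_number_circlepath by metis
  qed
qed simp_all

text \<open>Analysis is done entry by entry, where the scalar theory of contour integrals applies;
  the matrix-valued wrappers let the recurrences be written with \<open>**\<close>.\<close>

definition mat_holomorphic_on :: "(complex \<Rightarrow> complex ^ 'd ^ 'n) \<Rightarrow> complex set \<Rightarrow> bool" where
  "mat_holomorphic_on F S \<longleftrightarrow> (\<forall>i j. (\<lambda>z. F z $ i $ j) holomorphic_on S)"

definition mat_integrable :: "(real \<Rightarrow> complex) \<Rightarrow> (complex \<Rightarrow> complex ^ 'd ^ 'n) \<Rightarrow> bool" where
  "mat_integrable \<gamma> F \<longleftrightarrow> (\<forall>i j. (\<lambda>z. F z $ i $ j) contour_integrable_on \<gamma>)"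

definition mat_integral :: "(real \<Rightarrow> complex) \<Rightarrow> (complex \<Rightarrow> complex ^ 'd ^ 'n) \<Rightarrow> complex ^ 'd ^ 'n" where
  "mat_integral \<gamma> F = (\<chi> i j. contour_integral \<gamma> (\<lambda>z. F z $ i $ j))"


lemma mat_holomorphic_on_mult:
  "mat_holomorphic_on F S \<Longrightarrow> mat_holomorphic_on G S \<Longrightarrow> mat_holomorphic_on (\<lambda>z. F z ** G z) S"
  unfolding mat_holomorphic_on_def matrix_matrix_mult_def by (auto intro!: holomorphic_intros)

lemma mat_holomorphic_on_const: "mat_holomorphic_on (\<lambda>z. M) S"
  by (simp add: mat_holomorphic_on_def)

lemma mat_holomorphic_on_mat: "f holomorphic_on S \<Longrightarrow> mat_holomorphic_on (\<lambda>z. mat (f z)) S"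
  unfolding mat_holomorphic_on_def mat_component
  by (intro allI, case_tac "i = j") auto

lemma mat_holomorphic_on_resolvent: "S \<inter> mat_spectrum A = {} \<Longrightarrow> mat_holomorphic_on (resolvent A) S"
  unfolding mat_holomorphic_on_def
  by (intro allI holomorphic_on_subset[OF holomorphic_on_resolvent_entry]) blast

lemmas mat_holomorphic_intros =
  mat_holomorphic_on_mult mat_holomorphic_on_const mat_holomorphic_on_mat mat_holomorphic_on_resolvent

lemma mat_integrable_holomorphic:
  "mat_holomorphic_on F S \<Longrightarrow> open S \<Longrightarrow> valid_path \<gamma> \<Longrightarrow> path_image \<gamma> \<subseteq> S \<Longrightarrow> mat_integrable \<gamma> F"
  unfolding mat_holomorphic_on_def mat_integrable_def
  by (blast intro: contour_integrable_holomorphic_simple)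

lemma mat_integral_cong:
  "(\<And>z. z \<in> path_image \<gamma> \<Longrightarrow> F z = G z) \<Longrightarrow> mat_integral \<gamma> F = mat_integral \<gamma> G"
  unfolding mat_integral_def by (simp add: vec_eq_iff) (metis (mono_tags, lifting) contour_integral_eq)

lemma mat_integral_mat: "mat_integral \<gamma> (\<lambda>z. mat (f z)) = mat (contour_integral \<gamma> f)"
proof -
  have "contour_integral \<gamma> (\<lambda>z. mat (f z) $ i $ j) = mat (contour_integral \<gamma> f) $ i $ j" for i j :: 'a
    by (cases "i = j") (simp_all add: mat_component)
  then show ?thesis
    by (simp add: mat_integral_def vec_eq_iff)
qed

lemma mat_integral_add:
  "mat_integrable \<gamma> F \<Longrightarrow> mat_integrable \<gamma> G \<Longrightarrow>
   mat_integral \<gamma> (\<lambda>z. F z + G z) = mat_integral \<gamma> F + mat_integral \<gamma> G"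
  by (simp add: mat_integral_def mat_integrable_def vec_eq_iff contour_integral_add)

lemma mat_integrable_mult_left: "mat_integrable \<gamma> F \<Longrightarrow> mat_integrable \<gamma> (\<lambda>z. M ** F z)"
  by (auto simp: mat_integrable_def matrix_matrix_mult_def
      intro!: contour_integrable_sum contour_integrable_lmul)

lemma mat_integral_mult_left:
  "mat_integrable \<gamma> F \<Longrightarrow> mat_integral \<gamma> (\<lambda>z. M ** F z) = M ** mat_integral \<gamma> F"
  by (simp add: mat_integral_def mat_integrable_def matrix_matrix_mult_def vec_eq_iff
      contour_integral_sum contour_integral_lmul contour_integrable_lmul)

text \<open>All singularities lie inside the circle, so its radius may grow without changing the
  integral. Quadratic decay beats the linear growth of the length, so the integral is 0.\<close>

lemma contour_integral_circlepath_decay: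
  assumes hol: "f holomorphic_on - P" and P: "finite P" "P \<subseteq> ball 0 r" and "r > 0"
    and bound: "\<And>z. cmod z \<ge> R \<Longrightarrow> cmod (f z) \<le> C / (cmod z)\<^sup>2"
  shows "contour_integral (circlepath 0 r) f = 0"
proof -
  define I where "I = contour_integral (circlepath 0 r) f"
  \<comment> \<open>The absolute value of \<open>C\<close> is used because no sign of
    \<open>C\<close> is assumed.\<close>
  have I_le: "cmod I \<le> 2 * pi * \<bar>C\<bar> / \<rho>" if "\<rho> \<ge> max r R" for \<rho>
  proof -
    have \<rho>: "\<rho> \<ge> r" "\<rho> \<ge> R" "\<rho> > 0"
      using that \<open>r > 0\<close> by auto
    have P\<rho>: "P \<subseteq> ball 0 \<rho>"
      using P(2) \<rho>(1) by auto
    have img: "path_image (circlepath 0 s) \<subseteq> UNIV - P" if "P \<subseteq> ball 0 s" "s > 0" for s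
    proof
      fix z assume "z \<in> path_image (circlepath 0 s)"
      then have "cmod z = s"
        using that(2) by auto
      then show "z \<in> UNIV - P"
        using that(1) by auto
    qed
    have "I = contour_integral (circlepath 0 \<rho>) f"
      unfolding I_def
    proof (rule contour_integral_circlepath_eq[of UNIV P])
      show "f holomorphic_on UNIV - P"
        using hol by (simp add: Compl_eq_Diff_UNIV)
      show "path_image (circlepath 0 r) \<subseteq> UNIV - P"
        by (rule img) fact+
      show "winding_number (circlepath 0 r) p = 1" if "p \<in> P" for p
        using that P(2) by (intro winding_number_circlepath) auto
    qed (use P \<rho> P\<rho> in auto)
    moreover have "f contour_integrable_on circlepath 0 \<rho>"
      using hol img[OF P\<rho> \<rho>(3)] P(1)
      by (intro contour_integrable_holomorphic_simple[of _ "- P"])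
         (auto simp: Compl_eq_Diff_UNIV finite_imp_closed open_Diff)
    ultimately have "(f has_contour_integral I) (circlepath 0 \<rho>)"
      by (simp add: has_contour_integral_integral)
    then have "cmod I \<le> \<bar>C\<bar> / \<rho>\<^sup>2 * (2 * pi * \<rho>)"
    proof (rule has_contour_integral_bound_circlepath)
      show "cmod (f z) \<le> \<bar>C\<bar> / \<rho>\<^sup>2" if "cmod (z - 0) = \<rho>" for z
      proof -
        have "C / \<rho>\<^sup>2 \<le> \<bar>C\<bar> / \<rho>\<^sup>2"
          by (intro divide_right_mono) auto
        then show ?thesis
          using bound[of z] that \<rho>(2) by simp
      qed
    qed (use \<rho> in auto)
    also have "\<dots> = 2 * pi * \<bar>C\<bar> / \<rho>"
      using \<rho>(3) by (simp add: power2_eq_square)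
    finally show ?thesis .
  qed
  have "((\<lambda>\<rho>. 2 * pi * \<bar>C\<bar> / \<rho>) \<longlongrightarrow> 0) at_top"
    by (rule tendsto_divide_0[OF tendsto_const]) (rule filterlim_at_top_imp_at_infinity[OF filterlim_ident])
  then have "cmod I \<le> 0"
    by (rule tendsto_lowerbound)
       (use I_le in \<open>auto intro: eventually_at_top_linorderI[of "max r R"]\<close>)
  then show ?thesis
    by (simp add: I_def)
qed

section \<open>Integrals of resolvents over a circle around both spectra\<close>

locale spectral_circle =
  fixes r :: real and A :: "complex ^ 'n ^ 'n" and B :: "complex ^ 'd ^ 'd"
  assumes pos: "r > 0"
    and A_subset: "mat_spectrum A \<subseteq> ball 0 r"
    and B_subset: "mat_spectrum B \<subseteq> ball 0 r"
begin

abbreviation "spectra \<equiv> mat_spectrum A \<union> mat_spectrum B"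

lemma finite_spectra: "finite spectra"
  by (simp add: finite_mat_spectrum)

lemma circle_avoids_spectra: "path_image (circlepath 0 r) \<subseteq> - spectra"
proof
  fix z assume "z \<in> path_image (circlepath 0 r)"
  then have "cmod z = r"
    using pos by auto
  then show "z \<in> - spectra"
    using A_subset B_subset by auto
qed

lemma circle_nonzero: "z \<in> path_image (circlepath 0 r) \<Longrightarrow> z \<noteq> 0"
  using pos by auto

lemma circle_integrable:
  "mat_holomorphic_on F (- spectra) \<Longrightarrow> mat_integrable (circlepath 0 r) F"
  using circle_avoids_spectra finite_spectra
  by (intro mat_integrable_holomorphic[of F "- spectra"]) (auto simp: finite_imp_closed open_Compl)

text \<open>Dividing the resolvent recurrence by \<open>z\<close> splits the resolvent into
  \<open>1 / z\<close>, which integrates to \<open>2 * pi * \<i>\<close>, and a remainder that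
  decays quadratically.\<close>

lemma integral_resolvent: "mat_integral (circlepath 0 r) (resolvent B) = mat (2 * of_real pi * \<i>)"
proof -
  let ?F = "\<lambda>z. mat (1 / z) ** (B ** resolvent B z)"
  \<comment> \<open>The factor \<open>1 / z\<close> adds a singularity at 0.\<close>
  let ?P = "insert 0 (mat_spectrum B)"
  have "open (- ?P)"
    using finite_mat_spectrum[of B] by (auto simp: finite_imp_closed open_Compl)
  have hol: "mat_holomorphic_on (\<lambda>z. mat (1 / z) :: complex ^ 'd ^ 'd) (- ?P)" "mat_holomorphic_on ?F (- ?P)"
    by (auto intro!: mat_holomorphic_intros holomorphic_intros)
  have img: "path_image (circlepath 0 r) \<subseteq> - ?P"
    using circle_avoids_spectra circle_nonzero by blast
  have "mat_integral (circlepath 0 r) (resolvent B) =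
      mat_integral (circlepath 0 r) (\<lambda>z. mat (1 / z) + ?F z)"
  proof (rule mat_integral_cong)
    fix z assume z: "z \<in> path_image (circlepath 0 r)"
    then have "z \<notin> mat_spectrum B"
      using circle_avoids_spectra by blast
    from resolvent_recurrence[OF this]
    have "mat (1 / z) ** (mat z ** resolvent B z) = mat (1 / z) ** (mat 1 + B ** resolvent B z)"
      by simp
    moreover have "mat (1 / z) ** (mat z ** resolvent B z) = resolvent B z"
      using circle_nonzero[OF z] by (simp add: vec_eq_iff mat_mult_component)
    ultimately show "resolvent B z = mat (1 / z) + ?F z"
      by (simp add: matrix_add_ldistrib)
  qed
  also have "\<dots> = mat_integral (circlepath 0 r) (\<lambda>z. mat (1 / z)) + mat_integral (circlepath 0 r) ?F"
    by (rule mat_integral_add) (rule mat_integrable_holomorphic[OF _ \<open>open (- ?P)\<close> _ img], simp_all add: hol)+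
  also have "mat_integral (circlepath 0 r) (\<lambda>z. mat (1 / z)) = (mat (2 * of_real pi * \<i>) :: complex ^ 'd ^ 'd)"
  proof -
    have "contour_integral (circlepath 0 r) (\<lambda>z. 1 / z) = 2 * of_real pi * \<i>"
      using contour_integral_circlepath[OF pos, of 0] by simp
    then show ?thesis
      by (simp add: mat_integral_mat)
  qed
  also have "mat_integral (circlepath 0 r) ?F = 0"
  proof -
    obtain R where R: "R > 0"
        "\<And>z x. cmod z \<ge> R \<Longrightarrow> norm (resolvent B z *v x) \<le> 2 / cmod z * norm x"
      by (rule resolvent_bound[of B]) (rule that)
    obtain K where K: "K > 0" "\<And>x. norm (B *v x) \<le> K * norm x"
      by (rule matrix_vector_bound[of B]) (rule that)
    have "contour_integral (circlepath 0 r) (\<lambda>z. ?F z $ i $ j) = 0" for i j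
    proof (rule contour_integral_circlepath_decay)
      show "(\<lambda>z. ?F z $ i $ j) holomorphic_on - ?P"
        using hol(2) by (simp add: mat_holomorphic_on_def)
      \<comment> \<open>One factor \<open>1 / cmod z\<close> is explicit, the other comes with the
        constant 2 from the resolvent bound; \<open>K\<close> bounds \<open>B\<close>.\<close>
      show "cmod (?F z $ i $ j) \<le> (K * 2) / (cmod z)\<^sup>2" if "cmod z \<ge> R" for z
      proof -
        have "cmod ((B ** resolvent B z) $ i $ j) \<le> norm (B *v (resolvent B z *v axis j 1))"
          using norm_entry_le by (simp add: matrix_vector_mul_assoc)
        also have "\<dots> \<le> K * (2 / cmod z * norm (axis j (1::complex)))"
          using K(2)[of "resolvent B z *v axis j 1"] R(2)[OF that, of "axis j 1"] K(1)
          by (meson mult_left_mono less_imp_le order_trans)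
        finally show ?thesis
          using R(1) that
          by (simp add: mat_mult_component norm_mult norm_divide power2_eq_square divide_simps norm_axis_1)
      qed
    qed (use finite_mat_spectrum B_subset pos in auto)
    then show ?thesis
      by (simp add: mat_integral_def vec_eq_iff)
  qed
  finally show ?thesis by simp
qed

text \<open>Each resolvent contributes a factor \<open>2 / cmod z\<close>, so the integrand decays
  quadratically.\<close>

lemma integral_two_resolvents:
  "mat_integral (circlepath 0 r) (\<lambda>z. resolvent A z ** E ** resolvent B z) = 0"
proof -
  obtain R where R: "R > 0"
      "\<And>z x. cmod z \<ge> R \<Longrightarrow> norm (resolvent A z *v x) \<le> 2 / cmod z * norm x"
    by (rule resolvent_bound[of A]) (rule that)
  obtain S where S: "S > 0"
      "\<And>z x. cmod z \<ge> S \<Longrightarrow> norm (resolvent B z *v x) \<le> 2 / cmod z * norm x"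
    by (rule resolvent_bound[of B]) (rule that)
  obtain K where K: "K > 0" "\<And>x. norm (E *v x) \<le> K * norm x"
    by (rule matrix_vector_bound[of E]) (rule that)
  have hol: "mat_holomorphic_on (\<lambda>z. resolvent A z ** E ** resolvent B z) (- spectra)"
    by (auto intro!: mat_holomorphic_intros)
  have "contour_integral (circlepath 0 r) (\<lambda>z. (resolvent A z ** E ** resolvent B z) $ i $ j) = 0" for i j
  proof (rule contour_integral_circlepath_decay)
    show "(\<lambda>z. (resolvent A z ** E ** resolvent B z) $ i $ j) holomorphic_on - spectra"
      using hol by (simp add: mat_holomorphic_on_def)
    show "cmod ((resolvent A z ** E ** resolvent B z) $ i $ j) \<le> (4 * K) / (cmod z)\<^sup>2"
      if "cmod z \<ge> max R S" for z
    proof -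
      have z: "cmod z \<ge> R" "cmod z \<ge> S" "cmod z > 0"
        using that R(1) by auto
      let ?x = "resolvent B z *v axis j 1"
      have "cmod ((resolvent A z ** E ** resolvent B z) $ i $ j) \<le> norm (resolvent A z *v (E *v ?x))"
        using norm_entry_le[of "resolvent A z ** E ** resolvent B z" i j]
        by (simp add: matrix_vector_mul_assoc matrix_mul_assoc)
      also have "\<dots> \<le> 2 / cmod z * norm (E *v ?x)"
        by (rule R(2)) (fact z)
      also have "\<dots> \<le> 2 / cmod z * (K * norm ?x)"
        by (intro mult_left_mono K(2)) simp
      also have "\<dots> \<le> 2 / cmod z * (K * (2 / cmod z * norm (axis j (1::complex))))"
        using S(2)[OF z(2), of "axis j 1"] K(1) by (intro mult_left_mono) simp_all
      also have "\<dots> = (4 * K) / (cmod z)\<^sup>2"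
        by (simp add: power2_eq_square norm_axis_1)
      finally show ?thesis .
    qed
  qed (use finite_spectra A_subset B_subset pos in auto)
  then show ?thesis
    by (simp add: mat_integral_def vec_eq_iff)
qed

text \<open>The recurrence for the resolvent of \<open>B\<close> turns the integrand for
  \<open>Suc k\<close> into \<open>B\<close> times the one for \<open>k\<close> plus
  \<open>z ^ k\<close>, and the latter integrates to 0 by Cauchy's theorem.\<close>

lemma integral_power_resolvent:
  "mat_integral (circlepath 0 r) (\<lambda>z. mat (z ^ k) ** resolvent B z) = mat (2 * of_real pi * \<i>) ** mat_pow B k"
proof (induction k)
  case 0
  show ?case
    by (simp add: integral_resolvent)
next
  case (Suc k)
  have "mat_integral (circlepath 0 r) (\<lambda>z. mat (z ^ Suc k) ** resolvent B z) =
    mat_integral (circlepath 0 r) (\<lambda>z. mat (z ^ k) + B ** (mat (z ^ k) ** resolvent B z))"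
  proof (rule mat_integral_cong)
    fix z assume "z \<in> path_image (circlepath 0 r)"
    then have "z \<notin> mat_spectrum B"
      using circle_avoids_spectra by blast
    have "mat (z ^ Suc k) ** resolvent B z = mat (z ^ k) ** (mat z ** resolvent B z)"
      by (simp add: vec_eq_iff mat_mult_component)
    then show "mat (z ^ Suc k) ** resolvent B z = mat (z ^ k) + B ** (mat (z ^ k) ** resolvent B z)"
      by (simp add: resolvent_recurrence[OF \<open>z \<notin> mat_spectrum B\<close>] matrix_add_ldistrib mult_mat_commute)
  qed
  also have "\<dots> = mat_integral (circlepath 0 r) (\<lambda>z. mat (z ^ k))
      + mat_integral (circlepath 0 r) (\<lambda>z. B ** (mat (z ^ k) ** resolvent B z))"
    by (intro mat_integral_add circle_integrable mat_holomorphic_intros holomorphic_intros) auto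
  also have "mat_integral (circlepath 0 r) (\<lambda>z. mat (z ^ k)) = (0 :: complex ^ 'd ^ 'd)"
  proof -
    have "contour_integral (circlepath 0 r) (\<lambda>z. z ^ k) = 0"
      by (intro contour_integral_unique Cauchy_theorem_convex_simple[of _ UNIV] holomorphic_intros) auto
    then show ?thesis
      by (simp add: mat_integral_mat)
  qed
  also have "mat_integral (circlepath 0 r) (\<lambda>z. B ** (mat (z ^ k) ** resolvent B z))
      = B ** (mat (2 * of_real pi * \<i>) ** mat_pow B k)"
    unfolding Suc.IH[symmetric]
    by (intro mat_integral_mult_left circle_integrable mat_holomorphic_intros holomorphic_intros) auto
  finally show ?case
    by (simp add: mult_mat_commute)
qed

end

text \<open>The upper right block of the \<open>k\<close>-th power of the block matrix with rows \<open>A E\<close> and \<open>0 B\<close>.\<close>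

primrec dd_pow :: "complex ^ 'n ^ 'n \<Rightarrow> complex ^ 'd ^ 'd \<Rightarrow> complex ^ 'd ^ 'n \<Rightarrow> nat \<Rightarrow> complex ^ 'd ^ 'n" where
  "dd_pow A B E 0 = 0"
| "dd_pow A B E (Suc k) = A ** dd_pow A B E k + E ** mat_pow B k"

text \<open>Applying the recurrence to the resolvent of \<open>A\<close> leaves \<open>A\<close>
  times the previous integrand plus a term with the resolvent of \<open>B\<close> alone, matching
  the recursion of \<open>dd_pow\<close>.\<close>

lemma (in spectral_circle) integral_power_two_resolvents:
  "mat_integral (circlepath 0 r) (\<lambda>z. mat (z ^ k) ** (resolvent A z ** E ** resolvent B z))
    = mat (2 * of_real pi * \<i>) ** dd_pow A B E k"
proof (induction k)
  case 0
  show ?case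
    by (simp add: integral_two_resolvents)
next
  case (Suc k)
  let ?G = "\<lambda>z. resolvent A z ** E ** resolvent B z"
  have "mat_integral (circlepath 0 r) (\<lambda>z. mat (z ^ Suc k) ** ?G z) =
    mat_integral (circlepath 0 r) (\<lambda>z. A ** (mat (z ^ k) ** ?G z) + E ** (mat (z ^ k) ** resolvent B z))"
  proof (rule mat_integral_cong)
    fix z assume "z \<in> path_image (circlepath 0 r)"
    then have z: "z \<notin> mat_spectrum A"
      using circle_avoids_spectra by blast
    have "mat (z ^ Suc k) ** ?G z = mat (z ^ k) ** ((mat z ** resolvent A z) ** E ** resolvent B z)"
      by (simp add: vec_eq_iff mat_mult_component flip: matrix_mul_assoc)
    also have "\<dots> = mat (z ^ k) ** (E ** resolvent B z + A ** ?G z)"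
      by (simp add: resolvent_recurrence[OF z] matrix_add_rdistrib flip: matrix_mul_assoc)
    also have "\<dots> = A ** (mat (z ^ k) ** ?G z) + E ** (mat (z ^ k) ** resolvent B z)"
      by (simp add: matrix_add_ldistrib mult_mat_commute)
    finally show "mat (z ^ Suc k) ** ?G z = A ** (mat (z ^ k) ** ?G z) + E ** (mat (z ^ k) ** resolvent B z)" .
  qed
  also have "\<dots> = mat_integral (circlepath 0 r) (\<lambda>z. A ** (mat (z ^ k) ** ?G z))
      + mat_integral (circlepath 0 r) (\<lambda>z. E ** (mat (z ^ k) ** resolvent B z))"
    by (intro mat_integral_add circle_integrable mat_holomorphic_intros holomorphic_intros) auto
  also have "mat_integral (circlepath 0 r) (\<lambda>z. A ** (mat (z ^ k) ** ?G z))
      = A ** (mat (2 * of_real pi * \<i>) ** dd_pow A B E k)"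
    unfolding Suc.IH[symmetric]
    by (intro mat_integral_mult_left circle_integrable mat_holomorphic_intros holomorphic_intros) auto
  also have "mat_integral (circlepath 0 r) (\<lambda>z. E ** (mat (z ^ k) ** resolvent B z))
      = E ** (mat (2 * of_real pi * \<i>) ** mat_pow B k)"
    unfolding integral_power_resolvent[symmetric]
    by (intro mat_integral_mult_left circle_integrable mat_holomorphic_intros holomorphic_intros) auto
  finally show ?case
    by (simp add: mult_mat_commute matrix_add_ldistrib)
qed


section \<open>The power series of g\<close>

lemma pade_coeff_pos: "j \<le> m \<Longrightarrow> pade_coeff m j > 0"
  by (simp add: pade_coeff_def)

lemma pade_q_eq: "pade_q m z = (\<Sum>j\<le>m. (of_real (pade_coeff m j) * (- 1) ^ j) * z ^ j)"
  unfolding pade_q_def pade_p_def by (intro sum.cong) (auto simp: power_minus[of z])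

lemma pade_p_0: "pade_p m 0 = 1"
proof -
  have "pade_p m 0 = of_real (pade_coeff m 0)"
    unfolding pade_p_def by (subst sum.remove[of _ 0]) (auto intro!: sum.neutral)
  then show ?thesis
    by (simp add: pade_coeff_def)
qed

text \<open>The constant coefficient is positive, so the polynomial is not zero.\<close>

lemma finite_pade_roots: "finite {z. pade_q m z = 0}"
  unfolding pade_q_eq polyfun_finite_roots
  by (intro exI[of _ 0]) (use pade_coeff_pos[of 0 m] in simp)

text \<open>The leading coefficient is nonzero and the degree \<open>m\<close> is positive. A root
  is what makes the \<open>Min\<close> in \<open>pade_mu\<close> range over a nonempty set.\<close>

lemma pade_q_root_exists:
  assumes "m \<ge> 1"
  obtains z where "pade_q m z = 0"
proof -
  define a :: "nat \<Rightarrow> complex" where "a j = of_real (pade_coeff m j) * (- 1) ^ j" for j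
  have "a m \<noteq> 0"
    using pade_coeff_pos[of m m] by (simp add: a_def)
  then have "\<exists>i\<in>{1..m}. a i \<noteq> 0"
    using assms by (intro bexI[of _ m]) auto
  then obtain z where "(\<Sum>j\<le>m. a j * z ^ j) = 0"
    by (rule fundamental_theorem_of_algebra[OF disjI2])
  then have "pade_q m z = 0"
    by (simp only: pade_q_eq a_def)
  then show ?thesis
    by (rule that)
qed

lemma pade_mu_le: "pade_q m z = 0 \<Longrightarrow> pade_mu m \<le> cmod z"
  unfolding pade_mu_def using finite_pade_roots[of m] by (intro Min_le) auto

lemma pade_mu_pos:
  assumes "m \<ge> 1"
  shows "pade_mu m > 0"
proof -
  let ?M = "{cmod z |z. pade_q m z = 0}"
  have fin: "finite ?M"
    using finite_pade_roots[of m] by auto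
  obtain w where "pade_q m w = 0"
    using pade_q_root_exists[OF assms] .
  then have ne: "?M \<noteq> {}"
    by blast
  have "\<forall>x \<in> ?M. 0 < x"
  proof
    fix x assume "x \<in> ?M"
    then obtain z where z: "x = cmod z" "pade_q m z = 0"
      by blast
    have "z \<noteq> 0"
      using z(2) pade_p_0[of m] by (auto simp: pade_q_def)
    then show "0 < x"
      using z(1) by simp
  qed
  then show ?thesis
    unfolding pade_mu_def by (subst Min_gr_iff[OF fin ne])
qed

text \<open>The principal logarithm is used only near 0. It agrees there with a logarithm that is
  holomorphic on the whole disc, so both have the same Taylor coefficients \<open>a n\<close>, and
  the series converges on the disc. The \<open>b_coeff\<close> are those with odd index from
  \<open>2 * m + 1\<close> on.\<close>

lemma pade_log_series:
  assumes "m \<ge> 1"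
  obtains a where "\<And>k. b_coeff m k = a (2 * (m + k) + 1)"
    "\<And>w. cmod w < pade_mu m \<Longrightarrow> summable (\<lambda>n. a n * w ^ n)"
proof -
  define U where "U = ball (0::complex) (pade_mu m)"
  define F where "F = (\<lambda>z. exp (- z) * pade_r m z)"
  have q: "pade_q m z \<noteq> 0" if "z \<in> U" for z
    using that pade_mu_le[of m z] by (auto simp: U_def)
  \<comment> \<open>The numerator at \<open>z\<close> is the denominator at \<open>- z\<close>, and
    the disc is symmetric.\<close>
  have p: "pade_p m z \<noteq> 0" if "z \<in> U" for z
    using q[of "- z"] that by (simp add: U_def pade_q_def)
  have "pade_p m holomorphic_on S" "pade_q m holomorphic_on S" for S
    unfolding pade_p_def[abs_def] pade_q_eq[abs_def] by (intro holomorphic_intros)+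
  then have hol: "F holomorphic_on U"
    unfolding F_def pade_r_def using q by (intro holomorphic_intros) auto
  have nz: "F z \<noteq> 0" if "z \<in> U" for z
    using p[OF that] q[OF that] by (simp add: F_def pade_r_def)
  have zero: "0 \<in> U"
    using pade_mu_pos[OF assms] by (simp add: U_def)
  obtain g where g: "g holomorphic_on U" "\<And>z. z \<in> U \<Longrightarrow> exp (g z) = F z"
    using holomorphic_logarithm_exists[of U F 0] hol nz zero by (auto simp: U_def)
  \<comment> \<open>Normalised to vanish at 0; since \<open>exp (g 0) = F 0 = 1\<close>, the
    exponential is unchanged.\<close>
  define L where "L z = g z - g 0" for z
  have "F 0 = 1"
    using pade_p_0[of m] by (simp add: F_def pade_r_def pade_q_def)
  then have L: "L holomorphic_on U" "\<And>z. z \<in> U \<Longrightarrow> exp (L z) = F z"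
    using g zero unfolding L_def by (auto intro!: holomorphic_intros simp: exp_diff)
  \<comment> \<open>On this neighbourhood of 0 the imaginary part of \<open>L\<close> stays below 1
    and hence below pi, so \<open>Ln\<close> inverts \<open>exp\<close> at
    \<open>L z\<close>.\<close>
  define T where "T = U \<inter> L -` ball 0 1"
  have "open T"
    unfolding T_def using L(1)
    by (intro continuous_open_preimage holomorphic_on_imp_continuous_on) (auto simp: U_def)
  have LnF: "Ln (F z) = L z" if "z \<in> T" for z
  proof -
    have "\<bar>Im (L z)\<bar> < 1"
      using that abs_Im_le_cmod[of "L z"] by (simp add: T_def)
    then show ?thesis
      using that pi_gt3 by (subst L(2)[symmetric]) (auto simp: T_def intro!: Ln_exp)
  qed
  have LT: "L holomorphic_on T"
    using L(1) by (rule holomorphic_on_subset) (auto simp: T_def)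
  have "(deriv ^^ n) (\<lambda>z. Ln (F z)) 0 = (deriv ^^ n) L 0" for n
  proof (rule higher_deriv_transform_within_open[OF _ LT \<open>open T\<close>])
    show "(\<lambda>z. Ln (F z)) holomorphic_on T"
      by (rule holomorphic_transform[OF LT]) (simp add: LnF)
    show "0 \<in> T"
      using zero by (simp add: T_def L_def)
  qed (rule LnF)
  then have "b_coeff m k = (deriv ^^ (2 * (m + k) + 1)) L 0 / fact (2 * (m + k) + 1)" for k
    by (simp only: b_coeff_def F_def)
  moreover have "summable (\<lambda>n. (deriv ^^ n) L 0 / fact n * w ^ n)" if "cmod w < pade_mu m" for w
    using holomorphic_power_series[OF L(1)[unfolded U_def], of w] that by (auto simp: sums_iff)
  ultimately show ?thesis
    by (rule that)
qed

section \<open>Convergence and holomorphy of the series of g\<close>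

lemma strict_mono_odd_exponent: "strict_mono (\<lambda>k. 2 * (m + k) + 1 :: nat)"
  by (simp add: strict_mono_def)

lemma summable_g_fun:
  assumes "m \<ge> 1" "0 \<le> r" "r < pade_mu m"
  shows "summable (\<lambda>k. cmod (b_coeff m k) * r ^ (2 * (m + k) + 1))"
proof -
  obtain a where a: "\<And>k. b_coeff m k = a (2 * (m + k) + 1)"
    "\<And>w. cmod w < pade_mu m \<Longrightarrow> summable (\<lambda>n. a n * w ^ n)"
    using pade_log_series[OF assms(1)] by metis
  \<comment> \<open>Convergence at the larger radius \<open>s\<close> gives absolute convergence at
    \<open>r\<close>.\<close>
  obtain s where s: "r < s" "s < pade_mu m"
    using dense assms(3) by blast
  \<comment> \<open>Terms off the exponents in question are set to 0, so passing to the subsequence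
    of exponents preserves summability.\<close>
  define c where "c n = (if n \<in> range (\<lambda>k. 2 * (m + k) + 1) then cmod (a n) * r ^ n else 0)" for n
  have "summable (\<lambda>n. norm (a n * of_real r ^ n))"
    by (rule powser_insidea[of _ "of_real s"]) (use s assms(2) a(2)[of "of_real s"] in auto)
  then have "summable c"
    by (rule summable_comparison_test'[of _ 0])
       (use assms(2) in \<open>auto simp: c_def norm_mult norm_power\<close>)
  then have "summable (\<lambda>k. c (2 * (m + k) + 1))"
    by (subst summable_mono_reindex[OF strict_mono_odd_exponent]) (auto simp: c_def)
  then show ?thesis
    by (simp add: c_def a(1))
qed

lemma g_fun_sums:
  assumes "m \<ge> 1" "cmod z < pade_mu m"
  shows "(\<lambda>k. b_coeff m k * z ^ (2 * (m + k) + 1)) sums g_fun m z"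
proof -
  have "summable (\<lambda>k. norm (b_coeff m k * z ^ (2 * (m + k) + 1)))"
    using summable_g_fun[OF assms(1) _ assms(2)] by (simp add: norm_mult norm_power)
  then show ?thesis
    unfolding g_fun_def by (rule summable_sums[OF summable_norm_cancel])
qed

lemma g_fun_holomorphic:
  assumes "m \<ge> 1"
  shows "g_fun m holomorphic_on ball 0 (pade_mu m)"
proof -
  let ?h = "\<lambda>k. 2 * (m + k) + 1"
  \<comment> \<open>The series is filled up with zero terms to a full power series;
    \<open>(n - 1) div 2 - m\<close> recovers \<open>k\<close> from
    \<open>n = 2 * (m + k) + 1\<close>.\<close>
  define c where "c n = (if n \<in> range ?h then b_coeff m ((n - 1) div 2 - m) else 0)" for n
  have "(\<lambda>n. c n * (w - 0) ^ n) sums g_fun m w" if "w \<in> ball 0 (pade_mu m)" for w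
  proof (subst sums_mono_reindex[OF strict_mono_odd_exponent, symmetric])
    show "c n * (w - 0) ^ n = 0" if "n \<notin> range ?h" for n
      using that by (simp only: c_def if_False mult_zero_left)
    have "c (?h k) = b_coeff m k" for k
      by (simp add: c_def)
    then show "(\<lambda>k. c (?h k) * (w - 0) ^ ?h k) sums g_fun m w"
      using g_fun_sums[OF assms, of w] that by simp
  qed
  then show ?thesis
    by (rule power_series_holomorphic)
qed

text \<open>The Weierstrass M-test on the circle; this is what permits integration term by
  term.\<close>

lemma g_fun_uniform_limit:
  assumes "m \<ge> 1" "0 \<le> r" "r < pade_mu m"
  shows "uniform_limit (sphere 0 r) (\<lambda>n z. \<Sum>k<n. b_coeff m k * z ^ (2 * (m + k) + 1)) (g_fun m) sequentially"
  unfolding g_fun_def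
proof (rule Weierstrass_m_test)
  show "summable (\<lambda>k. cmod (b_coeff m k) * r ^ (2 * (m + k) + 1))"
    by (rule summable_g_fun) fact+
qed (auto simp: norm_mult norm_power)


section \<open>Vector norms and induced norms\<close>

lemma
  assumes "is_vector_norm N"
  shows vector_norm_nonneg: "N x \<ge> 0"
    and vector_norm_zero: "N 0 = 0"
    and vector_norm_pos: "x \<noteq> 0 \<Longrightarrow> N x > 0"
    and vector_norm_smult: "N (c *s x) = cmod c * N x"
    and vector_norm_triangle: "N (x + y) \<le> N x + N y"
  using assms unfolding is_vector_norm_def by (blast, blast, metis less_eq_real_def, blast, blast)

text \<open>Expand \<open>x\<close> in the standard basis and bound each coordinate by the Euclidean
  norm.\<close>

lemma vector_norm_le:
  fixes N :: "complex ^ 'n \<Rightarrow> real"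
  assumes N: "is_vector_norm N"
  shows "N x \<le> (\<Sum>i\<in>UNIV. N (axis i 1)) * norm x"
proof -
  have sum_le: "N (\<Sum>i\<in>I. f i) \<le> (\<Sum>i\<in>I. N (f i))" if "finite I" for I and f :: "'n \<Rightarrow> complex ^ 'n"
    using that
  proof induction
    case empty
    show ?case
      by (simp add: vector_norm_zero[OF N])
  next
    case (insert i I)
    then show ?case
      using vector_norm_triangle[OF N, of "f i" "\<Sum>i\<in>I. f i"] by simp
  qed
  have "x = (\<Sum>i\<in>UNIV. x $ i *s axis i 1)"
    by (simp add: vec_eq_iff axis_def if_distrib sum.delta cong: if_cong)
  then have "N x \<le> (\<Sum>i\<in>UNIV. N (x $ i *s axis i 1))"
    by (metis sum_le finite_class.finite_UNIV)
  also have "\<dots> \<le> (\<Sum>i\<in>UNIV. N (axis i 1) * norm x)"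
  proof (rule sum_mono)
    fix i
    have "N (axis i 1) * cmod (x $ i) \<le> N (axis i 1) * norm x"
      by (intro mult_left_mono Finite_Cartesian_Product.norm_nth_le vector_norm_nonneg[OF N])
    then show "N (x $ i *s axis i 1) \<le> N (axis i 1) * norm x"
      by (simp add: vector_norm_smult[OF N] mult.commute)
  qed
  finally show ?thesis
    by (simp add: sum_distrib_right)
qed

lemma vector_norm_minus:
  assumes "is_vector_norm N"
  shows "N (- x) = N x"
proof -
  have "(- 1) *s x = - x"
    by (simp add: vec_eq_iff)
  then show ?thesis
    using vector_norm_smult[OF assms, of "- 1" x] by simp
qed

lemma vector_norm_diff_le:
  assumes "is_vector_norm N"
  shows "\<bar>N x - N y\<bar> \<le> N (x - y)"
proof -
  have "N x \<le> N (x - y) + N y" "N y \<le> N (y - x) + N x"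
    using vector_norm_triangle[OF assms, of "x - y" y] vector_norm_triangle[OF assms, of "y - x" x]
    by simp_all
  moreover have "N (y - x) = N (x - y)"
    using vector_norm_minus[OF assms, of "x - y"] by simp
  ultimately show ?thesis by linarith
qed

lemma continuous_on_vector_norm:
  fixes N :: "complex ^ 'n \<Rightarrow> real"
  assumes "is_vector_norm N"
  shows "continuous_on S N"
proof (rule continuous_on_subset[of UNIV])
  define C where "C = (\<Sum>i\<in>UNIV. N (axis i 1))"
  have "C \<ge> 0"
    unfolding C_def by (intro sum_nonneg vector_norm_nonneg[OF assms])
  have "C-lipschitz_on UNIV N"
  proof (rule lipschitz_onI)
    show "dist (N x) (N y) \<le> C * dist x y" for x y
      using vector_norm_diff_le[OF assms, of x y] vector_norm_le[OF assms, of "x - y"]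
      by (simp add: dist_norm C_def)
  qed fact
  then show "continuous_on UNIV N"
    by (rule lipschitz_on_continuous_on)
qed simp

text \<open>The constant is the minimum of \<open>N\<close> on the compact Euclidean unit sphere,
  where \<open>N\<close> is continuous and positive; homogeneity extends the bound to all
  vectors.\<close>

lemma vector_norm_ge:
  fixes N :: "complex ^ 'n \<Rightarrow> real"
  assumes N: "is_vector_norm N"
  obtains c where "c > 0" "\<And>x. c * norm x \<le> N x"
proof -
  \<comment> \<open>Any basis vector shows that the sphere is nonempty.\<close>
  have "axis undefined 1 \<in> sphere (0 :: complex ^ 'n) 1"
    by (simp add: norm_axis_1)
  then have ne: "sphere (0 :: complex ^ 'n) 1 \<noteq> {}"
    by blast
  obtain u where u: "u \<in> sphere 0 1" "\<And>y. y \<in> sphere 0 1 \<Longrightarrow> N u \<le> N y"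
    using continuous_attains_inf[OF compact_sphere ne continuous_on_vector_norm[OF N]] by blast
  show ?thesis
  proof
    have "u \<noteq> 0"
      using u(1) by auto
    then show "N u > 0"
      by (rule vector_norm_pos[OF N])
    show "N u * norm x \<le> N x" for x
    proof (cases "x = 0")
      case True
      then show ?thesis
        by (simp add: vector_norm_zero[OF N])
    next
      case False
      define y where "y = of_real (inverse (norm x)) *s x"
      have "norm y = 1"
        using False by (simp add: y_def norm_vector_smult norm_inverse)
      then have "N u \<le> N y"
        using u(2) by simp
      also have "N y = N x / norm x"
        unfolding y_def vector_norm_smult[OF N] by (simp add: norm_inverse divide_inverse mult.commute)
      finally show ?thesis
        using False by (simp add: le_divide_eq)
    qed
  qed
qed

text \<open>Both norms are comparable with the Euclidean one, which gives the bound
  \<open>C * K / c\<close>. Boundedness makes the \<open>SUP\<close> in \<open>induced_norm\<close>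
  a true supremum.\<close>

lemma induced_norm_bdd_above:
  assumes N1: "is_vector_norm N1" and N2: "is_vector_norm N2"
  shows "bdd_above (range (\<lambda>x. N2 (M *v x) / N1 x))"
proof -
  define C where "C = (\<Sum>i\<in>UNIV. N2 (axis i 1))"
  have C: "C \<ge> 0" "\<And>x. N2 x \<le> C * norm x"
    unfolding C_def by (intro sum_nonneg vector_norm_nonneg[OF N2], rule vector_norm_le[OF N2])
  obtain K where K: "K > 0" "\<And>x. norm (M *v x) \<le> K * norm x"
    by (rule matrix_vector_bound[of M]) (rule that)
  obtain c where c: "c > 0" "\<And>x. c * norm x \<le> N1 x"
    by (rule vector_norm_ge[OF N1]) (rule that)
  have "N2 (M *v x) / N1 x \<le> C * K / c" for x
  proof (cases "x = 0")
    case True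
    then show ?thesis
      using C(1) K(1) c(1) by (simp add: vector_norm_zero[OF N1])
  next
    case False
    then have pos: "N1 x > 0"
      by (rule vector_norm_pos[OF N1])
    have "N2 (M *v x) \<le> C * (K * norm x)"
      using C(2)[of "M *v x"] K(2)[of x] C(1) by (meson mult_left_mono order_trans)
    also have "\<dots> = C * K / c * (c * norm x)"
      using c(1) by simp
    also have "\<dots> \<le> C * K / c * N1 x"
      using C(1) K(1) c by (intro mult_left_mono) auto
    finally show ?thesis
      using pos by (simp add: divide_le_eq)
  qed
  then show ?thesis
    by (auto simp: bdd_above_def)
qed

lemma induced_norm_bound:
  assumes N1: "is_vector_norm N1" and N2: "is_vector_norm N2"
  shows "N2 (M *v x) \<le> induced_norm N1 N2 M * N1 x"
proof (cases "x = 0")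
  case True
  then show ?thesis
    by (simp add: vector_norm_zero[OF N1] vector_norm_zero[OF N2])
next
  case False
  then have "N1 x > 0"
    by (rule vector_norm_pos[OF N1])
  moreover have "N2 (M *v x) / N1 x \<le> induced_norm N1 N2 M"
    unfolding induced_norm_def by (rule cSUP_upper[OF _ induced_norm_bdd_above[OF N1 N2]]) simp
  ultimately show ?thesis
    by (simp add: divide_le_eq)
qed

lemma induced_norm_nonneg:
  assumes N1: "is_vector_norm N1" and N2: "is_vector_norm N2"
  shows "induced_norm N1 N2 M \<ge> 0"
proof -
  \<comment> \<open>The zero vector contributes the value 0 to the supremum.\<close>
  have "N2 (M *v 0) / N1 0 \<le> induced_norm N1 N2 M"
    unfolding induced_norm_def by (rule cSUP_upper[OF _ induced_norm_bdd_above[OF N1 N2]]) simp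
  then show ?thesis
    by (simp add: vector_norm_zero[OF N2])
qed

lemma induced_norm_least:
  assumes N1: "is_vector_norm N1" and "C \<ge> 0" and "\<And>x. N2 (M *v x) \<le> C * N1 x"
  shows "induced_norm N1 N2 M \<le> C"
  unfolding induced_norm_def
proof (rule cSUP_least)
  show "N2 (M *v x) / N1 x \<le> C" for x
  proof (cases "N1 x = 0")
    case False
    then have "N1 x > 0"
      using vector_norm_nonneg[OF N1, of x] by simp
    then show ?thesis
      using assms(3) by (simp add: divide_le_eq)
  \<comment> \<open>For \<open>N1 x = 0\<close> the quotient is 0 by convention, and
    \<open>C\<close> is nonnegative.\<close>
  qed (use assms(2) in simp)
qed simp

section \<open>Norm bounds for matrix powers and their divided differences\<close>

lemma mat_pow_bound:
  fixes N :: "complex ^ 'n \<Rightarrow> real"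
  assumes "\<And>v. N (B *v v) \<le> x * N v" "x \<ge> 0"
  shows "N (mat_pow B k *v v) \<le> x ^ k * N v"
proof (induction k)
  case (Suc k)
  have "N (mat_pow B (Suc k) *v v) \<le> x * N (mat_pow B k *v v)"
    using assms(1) by (simp flip: matrix_vector_mul_assoc)
  also have "\<dots> \<le> x * (x ^ k * N v)"
    using Suc.IH assms(2) by (rule mult_left_mono)
  finally show ?case by simp
qed simp

text \<open>Unrolled, \<open>dd_pow\<close> is a sum of \<open>k\<close> products of a power of
  \<open>A\<close>, the matrix \<open>E\<close> and a power of \<open>B\<close>, with
  \<open>k - 1\<close> factors besides \<open>E\<close>. For \<open>k = 0\<close> the factor
  \<open>real k\<close> makes the truncated exponent harmless.\<close>

lemma dd_pow_bound:
  assumes tri: "\<And>u v. N1 (u + v) \<le> N1 u + N1 v" and zero: "N1 0 = 0"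
    and A: "\<And>v. N1 (A *v v) \<le> x * N1 v" and B: "\<And>v. N2 (B *v v) \<le> x * N2 v"
    and E: "\<And>v. N1 (E *v v) \<le> e * N2 v"
    and "x \<ge> 0" "e \<ge> 0"
  shows "N1 (dd_pow A B E k *v v) \<le> real k * e * x ^ (k - 1) * N2 v"
proof (induction k)
  case 0
  show ?case by (simp add: zero)
next
  case (Suc k)
  have "N1 (dd_pow A B E (Suc k) *v v)
      \<le> N1 (A *v (dd_pow A B E k *v v)) + N1 (E *v (mat_pow B k *v v))"
    using tri by (simp add: matrix_vector_mult_add_rdistrib flip: matrix_vector_mul_assoc)
  also have "\<dots> \<le> x * N1 (dd_pow A B E k *v v) + e * N2 (mat_pow B k *v v)"
    by (intro add_mono A E)
  also have "\<dots> \<le> x * (real k * e * x ^ (k - 1) * N2 v) + e * (x ^ k * N2 v)"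
    by (intro add_mono mult_left_mono Suc.IH mat_pow_bound[of N2] B \<open>x \<ge> 0\<close> \<open>e \<ge> 0\<close>)
  also have "\<dots> = real (Suc k) * e * x ^ (Suc k - 1) * N2 v"
    \<comment> \<open>The case split resolves the truncated subtraction
      \<open>k - 1\<close>.\<close>
    by (cases k) (simp_all add: algebra_simps)
  finally show ?case .
qed


section \<open>The backward error as a power series\<close>

text \<open>This supplies an admissible contour, so that the \<open>SOME\<close> in
  \<open>D_op\<close> denotes one.\<close>

lemma encloses_circlepath:
  assumes "r > 0" "S \<subseteq> ball 0 r" "cball 0 r \<subseteq> \<Omega>"
  shows "encloses_once \<Omega> S (circlepath 0 r)"
proof -
  have wn: "winding_number (circlepath 0 r) z = 1" if "z \<in> S" for z
    using that assms(2) by (intro winding_number_circlepath) auto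
  \<comment> \<open>A point outside would have winding number 0 instead of 1.\<close>
  have "z \<in> inside (path_image (circlepath 0 r))" if "z \<in> S" for z
  proof (rule ccontr)
    assume "z \<notin> inside (path_image (circlepath 0 r))"
    moreover have "z \<notin> path_image (circlepath 0 r)"
      using that assms(2) by (intro notin_path_image_circlepath) auto
    ultimately have "z \<in> outside (path_image (circlepath 0 r))"
      using inside_Un_outside by blast
    then have "winding_number (circlepath 0 r) z = 0"
      by (intro winding_number_zero_in_outside) (simp_all add: valid_path_imp_path)
    then show False
      using wn[OF that] by simp
  qed
  moreover have "path_image (circlepath 0 r) \<subseteq> \<Omega>"
    using assms(1,3) sphere_cball[of 0 r] by auto
  ultimately show ?thesis
    using assms(1) wn by (auto simp: encloses_once_def simple_path_circlepath)
qed

lemma resolvent_integral_eq: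
  "resolvent_integral \<gamma> f A B E = mat (1 / (2 * of_real pi * \<i>)) **
     mat_integral \<gamma> (\<lambda>z. mat (f z) ** (resolvent A z ** E ** resolvent B z))"
  by (simp add: vec_eq_iff resolvent_integral_def mat_mult_component mat_integral_def)

lemma mat_integral_sum:
  "finite I \<Longrightarrow> (\<And>k. k \<in> I \<Longrightarrow> mat_integrable \<gamma> (F k)) \<Longrightarrow>
   mat_integral \<gamma> (\<lambda>z. \<Sum>k\<in>I. F k z) = (\<Sum>k\<in>I. mat_integral \<gamma> (F k))"
  by (simp add: mat_integral_def mat_integrable_def vec_eq_iff contour_integral_sum)

text \<open>On the circle the resolvent factor is bounded, so multiplying by it preserves uniform
  convergence, and the integrals of the partial sums converge to that of the limit, entry by
  entry.\<close>

lemma (in spectral_circle) integral_power_series: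
  assumes f: "uniform_limit (sphere 0 r) (\<lambda>n z. \<Sum>k<n. c k * z ^ h k) f sequentially"
  shows "(\<lambda>k. mat (c k) ** dd_pow A B E (h k)) sums
    (mat (1 / (2 * of_real pi * \<i>)) **
      mat_integral (circlepath 0 r) (\<lambda>z. mat (f z) ** (resolvent A z ** E ** resolvent B z)))"
proof -
  let ?C = "circlepath 0 r"
  let ?G = "\<lambda>z. resolvent A z ** E ** resolvent B z"
  let ?p = "\<lambda>n z. \<Sum>k<n. c k * z ^ h k"
  have sphere: "sphere 0 r = path_image ?C"
    using pos by simp
  have hol: "mat_holomorphic_on ?G (- spectra)"
    by (auto intro!: mat_holomorphic_intros)
  have partial: "mat_integral ?C (\<lambda>z. mat (?p n z) ** ?G z)
      = mat (2 * of_real pi * \<i>) ** (\<Sum>k<n. mat (c k) ** dd_pow A B E (h k))" for n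
  proof -
    have int: "mat_integrable ?C (\<lambda>z. mat (z ^ h k) ** ?G z)" for k
      by (intro circle_integrable mat_holomorphic_on_mult[OF _ hol] mat_holomorphic_on_mat holomorphic_intros)
    have "mat_integral ?C (\<lambda>z. mat (?p n z) ** ?G z)
        = mat_integral ?C (\<lambda>z. \<Sum>k<n. mat (c k) ** (mat (z ^ h k) ** ?G z))"
      by (rule mat_integral_cong) (simp add: vec_eq_iff mat_mult_component sum_distrib_right mult.assoc)
    also have "\<dots> = (\<Sum>k<n. mat (c k) ** mat_integral ?C (\<lambda>z. mat (z ^ h k) ** ?G z))"
      by (simp add: mat_integral_sum mat_integrable_mult_left mat_integral_mult_left int)
    also have "\<dots> = mat (2 * of_real pi * \<i>) ** (\<Sum>k<n. mat (c k) ** dd_pow A B E (h k))"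
      by (simp add: integral_power_two_resolvents vec_eq_iff mat_mult_component sum_distrib_left
          mult.left_commute)
    finally show ?thesis .
  qed
  have "(\<lambda>n. (\<Sum>k<n. mat (c k) ** dd_pow A B E (h k)) $ i $ j) \<longlonglongrightarrow>
      (mat (1 / (2 * of_real pi * \<i>)) ** mat_integral ?C (\<lambda>z. mat (f z) ** ?G z)) $ i $ j" for i j
  proof -
    have Gij: "(\<lambda>z. ?G z $ i $ j) holomorphic_on - spectra"
      using hol by (simp add: mat_holomorphic_on_def)
    have "(\<lambda>n. contour_integral ?C (\<lambda>z. ?p n z * ?G z $ i $ j)) \<longlonglongrightarrow>
        contour_integral ?C (\<lambda>z. f z * ?G z $ i $ j)"
    proof (rule contour_integral_uniform_limit_circlepath(2))
      have "(\<lambda>z. ?p n z * ?G z $ i $ j) contour_integrable_on ?C" for n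
      proof (rule contour_integrable_holomorphic_simple)
        show "(\<lambda>z. ?p n z * ?G z $ i $ j) holomorphic_on - spectra"
          by (intro holomorphic_intros Gij)
        show "open (- spectra)"
          by (rule open_Compl[OF finite_imp_closed[OF finite_spectra]])
      qed (use circle_avoids_spectra in auto)
      then show "\<forall>\<^sub>F n in sequentially. (\<lambda>z. ?p n z * ?G z $ i $ j) contour_integrable_on ?C"
        by simp
      have "continuous_on (sphere 0 r) (\<lambda>z. ?G z $ i $ j)"
        using holomorphic_on_subset[OF Gij circle_avoids_spectra]
        unfolding sphere by (rule holomorphic_on_imp_continuous_on)
      then have bG: "bounded ((\<lambda>z. ?G z $ i $ j) ` sphere 0 r)"
        by (intro compact_imp_bounded compact_continuous_image compact_sphere)
      \<comment> \<open>As a uniform limit of polynomials, \<open>f\<close> is continuous and hence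
        bounded on the circle, as needed for the limit of the product.\<close>
      have "continuous_on (sphere 0 r) f"
        by (rule uniform_limit_theorem[OF _ f]) (auto intro!: always_eventually continuous_intros)
      then have bf: "bounded (f ` sphere 0 r)"
        by (intro compact_imp_bounded compact_continuous_image compact_sphere)
      show "uniform_limit (sphere 0 r) (\<lambda>n z. ?p n z * ?G z $ i $ j) (\<lambda>z. f z * ?G z $ i $ j) sequentially"
        by (intro uniform_lim_mult f uniform_limit_const bf bG)
    qed (use pos in auto)
    then have "(\<lambda>n. mat_integral ?C (\<lambda>z. mat (?p n z) ** ?G z) $ i $ j) \<longlonglongrightarrow>
        mat_integral ?C (\<lambda>z. mat (f z) ** ?G z) $ i $ j"
      by (simp add: mat_integral_def mat_mult_component)
    then have "(\<lambda>n. 1 / (2 * of_real pi * \<i>) * mat_integral ?C (\<lambda>z. mat (?p n z) ** ?G z) $ i $ j)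
        \<longlonglongrightarrow> 1 / (2 * of_real pi * \<i>) * mat_integral ?C (\<lambda>z. mat (f z) ** ?G z) $ i $ j"
      by (rule tendsto_mult_left)
    then show ?thesis
      unfolding partial mat_mult_component by simp
  qed
  then show ?thesis
    unfolding sums_def by (intro vec_tendstoI)
qed

lemma D_op_g_fun_sums:
  assumes m: "m \<ge> 1" and A: "spec_radius A < pade_mu m" and B: "spec_radius B < pade_mu m"
  shows "(\<lambda>k. mat (b_coeff m k) ** dd_pow A B E (2 * (m + k) + 1)) sums
    D_op (g_fun m) (ball 0 (pade_mu m)) A B E"
proof -
  define \<Omega> where "\<Omega> = ball (0 :: complex) (pade_mu m)"
  let ?S = "mat_spectrum A \<union> mat_spectrum B"
  \<comment> \<open>Including 0 in the maximum ensures that the radius is positive.\<close>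
  obtain r where "max (max (spec_radius A) (spec_radius B)) 0 < r" "r < pade_mu m"
    using dense[of "max (max (spec_radius A) (spec_radius B)) 0" "pade_mu m"] A B pade_mu_pos[OF m] by auto
  then have r: "spec_radius A < r" "spec_radius B < r" "0 < r" "r < pade_mu m"
    by auto
  interpret spectral_circle r A B
    using r mat_spectrum_subset_cball[of A] mat_spectrum_subset_cball[of B]
    by unfold_locales fastforce+
  have cball: "cball 0 r \<subseteq> \<Omega>"
    using r(4) by (auto simp: \<Omega>_def)
  have S: "?S \<subseteq> ball 0 r"
    using A_subset B_subset by blast
  define \<Gamma> where "\<Gamma> = (SOME \<Gamma>. encloses_once \<Omega> ?S \<Gamma>)"
  \<comment> \<open>The circle of radius \<open>r\<close> witnesses existence, so the chosen contour
    is admissible as well.\<close>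
  have "encloses_once \<Omega> ?S \<Gamma>"
    unfolding \<Gamma>_def by (rule someI[where P = "encloses_once \<Omega> ?S", OF encloses_circlepath[OF r(3) S cball]])
  \<comment> \<open>The spectra lie inside the contour, and inside points are never on the path, so
    the contour avoids them.\<close>
  then have \<Gamma>: "valid_path \<Gamma>" "pathfinish \<Gamma> = pathstart \<Gamma>" "path_image \<Gamma> \<subseteq> \<Omega> - ?S"
      "\<And>z. z \<in> ?S \<Longrightarrow> winding_number \<Gamma> z = 1"
    using inside_no_overlap[of "path_image \<Gamma>"] unfolding encloses_once_def by blast+
  let ?F = "\<lambda>z. mat (g_fun m z) ** (resolvent A z ** E ** resolvent B z)"
  have hol: "mat_holomorphic_on ?F (\<Omega> - ?S)"
  proof (intro mat_holomorphic_intros)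
    show "g_fun m holomorphic_on \<Omega> - ?S"
      using g_fun_holomorphic[OF m, folded \<Omega>_def] by (rule holomorphic_on_subset) auto
  qed auto
  have "contour_integral \<Gamma> (\<lambda>z. ?F z $ i $ j) = contour_integral (circlepath 0 r) (\<lambda>z. ?F z $ i $ j)" for i j
  proof (rule contour_integral_circlepath_eq)
    show "open \<Omega>" "convex \<Omega>"
      by (simp_all add: \<Omega>_def)
    show "(\<lambda>z. ?F z $ i $ j) holomorphic_on \<Omega> - ?S"
      using hol by (simp add: mat_holomorphic_on_def)
  qed (fact finite_spectra \<Gamma> r(3) S cball)+
  then have "mat_integral \<Gamma> ?F = mat_integral (circlepath 0 r) ?F"
    by (simp add: mat_integral_def)
  then have "D_op (g_fun m) \<Omega> A B E = mat (1 / (2 * of_real pi * \<i>)) ** mat_integral (circlepath 0 r) ?F"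
    unfolding D_op_def \<Gamma>_def[symmetric] resolvent_integral_eq by simp
  then show ?thesis
    using integral_power_series[OF g_fun_uniform_limit[OF m _ r(4)], of E] r(3) by (simp add: \<Omega>_def)
qed

lemma sum_matrix_vector: "(\<Sum>k\<in>I. M k) *v v = (\<Sum>k\<in>I. M k *v v)"
  by (induction I rule: infinite_finite_induct) (simp_all add: matrix_vector_mult_add_rdistrib)

text \<open>Taking \<open>k\<close> to be \<open>2 * (m + k) + 1\<close> in
  \<open>dd_pow_bound\<close> yields exactly the factor and the exponent of the differentiated
  series. The bound for partial sums passes to the limit because \<open>N1\<close> is
  continuous.\<close>

lemma vector_norm_D_op_le:
  assumes m: "m \<ge> 1" and spec: "spec_radius A < pade_mu m" "spec_radius B < pade_mu m"
    and N1: "is_vector_norm N1" and N2: "is_vector_norm N2"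
    and A: "\<And>v. N1 (A *v v) \<le> x * N1 v" and B: "\<And>v. N2 (B *v v) \<le> x * N2 v"
    and E: "\<And>v. N1 (E *v v) \<le> e * N2 v" and "x \<ge> 0" "e \<ge> 0"
    and summable: "summable (\<lambda>k. real (2 * (m + k) + 1) * cmod (b_coeff m k) * x ^ (2 * (m + k)))"
  shows "N1 (D_op (g_fun m) (ball 0 (pade_mu m)) A B E *v v)
    \<le> (\<Sum>k. real (2 * (m + k) + 1) * cmod (b_coeff m k) * x ^ (2 * (m + k))) * e * N2 v"
proof -
  let ?t = "\<lambda>k. real (2 * (m + k) + 1) * cmod (b_coeff m k) * x ^ (2 * (m + k))"
  let ?D = "D_op (g_fun m) (ball 0 (pade_mu m)) A B E"
  let ?M = "\<lambda>k. mat (b_coeff m k) ** dd_pow A B E (2 * (m + k) + 1)"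
  have term_le: "N1 (?M k *v v) \<le> ?t k * e * N2 v" for k
  proof -
    have "N1 (?M k *v v) = cmod (b_coeff m k) * N1 (dd_pow A B E (2 * (m + k) + 1) *v v)"
      by (simp only: mat_mult_vector vector_norm_smult[OF N1] flip: matrix_vector_mul_assoc)
    also have "\<dots> \<le> cmod (b_coeff m k) *
        (real (2 * (m + k) + 1) * e * x ^ (2 * (m + k) + 1 - 1) * N2 v)"
      using vector_norm_triangle[OF N1] vector_norm_zero[OF N1] A B E \<open>x \<ge> 0\<close> \<open>e \<ge> 0\<close>
      by (intro mult_left_mono dd_pow_bound) auto
    finally show ?thesis
      by (simp only: mult_ac add_diff_cancel_right')
  qed
  have partial_le: "N1 ((\<Sum>k<n. ?M k) *v v) \<le> suminf ?t * e * N2 v" for n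
  proof -
    have "N1 (\<Sum>k<n. ?M k *v v) \<le> (\<Sum>k<n. N1 (?M k *v v))"
      by (induction n) (use vector_norm_zero[OF N1] vector_norm_triangle[OF N1] in
          \<open>auto intro: order_trans[OF vector_norm_triangle[OF N1]]\<close>)
    also have "\<dots> \<le> (\<Sum>k<n. ?t k * e * N2 v)"
      by (intro sum_mono term_le)
    also have "\<dots> = (\<Sum>k<n. ?t k) * (e * N2 v)"
      by (simp only: sum_distrib_right mult.assoc)
    also have "\<dots> \<le> suminf ?t * (e * N2 v)"
      using \<open>x \<ge> 0\<close> \<open>e \<ge> 0\<close> vector_norm_nonneg[OF N2, of v]
      by (intro mult_right_mono sum_le_suminf[OF summable]) auto
    finally show ?thesis
      by (simp add: sum_matrix_vector mult.assoc)
  qed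
  have "(\<lambda>n. \<Sum>k<n. ?M k) \<longlonglongrightarrow> ?D"
    using D_op_g_fun_sums[OF m spec, of E] by (simp add: sums_def)
  then have "(\<lambda>n. (\<Sum>k<n. ?M k) *v v) \<longlonglongrightarrow> ?D *v v"
    unfolding matrix_vector_mult_def by (intro tendsto_intros)
  then have "(\<lambda>n. N1 ((\<Sum>k<n. ?M k) *v v)) \<longlonglongrightarrow> N1 (?D *v v)"
    using continuous_on_tendsto_compose[OF continuous_on_vector_norm[OF N1, of UNIV]] by simp
  then show ?thesis
    by (rule LIMSEQ_le_const2) (use partial_le in blast)
qed

section \<open>The bound for the backward error\<close>

lemma scaleR_induced_norm_bound:
  assumes N: "is_vector_norm N" and "c \<ge> 0" "induced_norm N N M \<le> b"
  shows "N ((c *\<^sub>R M) *v v) \<le> c * b * N v"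
proof -
  have "(c *\<^sub>R M) *v v = of_real c *s (M *v v)"
    unfolding vec_eq_iff matrix_vector_mult_def
    by (simp add: sum_distrib_left) (simp add: scaleR_conv_of_real)
  then have "N ((c *\<^sub>R M) *v v) = c * N (M *v v)"
    using vector_norm_smult[OF N] \<open>c \<ge> 0\<close> by simp
  also have "\<dots> \<le> c * (induced_norm N N M * N v)"
    by (intro mult_left_mono induced_norm_bound N \<open>c \<ge> 0\<close>)
  also have "\<dots> \<le> c * (b * N v)"
    by (intro mult_left_mono mult_right_mono vector_norm_nonneg N assms(2,3))
  finally show ?thesis
    by (simp add: mult.assoc)
qed

theorem theorem3p2:
  fixes m s :: nat
    and A :: "complex ^ 'n ^ 'n" and B :: "complex ^ 'd ^ 'd" and E :: "complex ^ 'd ^ 'n"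
    and N\<^sub>n :: "complex ^ 'n \<Rightarrow> real" and N\<^sub>d :: "complex ^ 'd \<Rightarrow> real"
  assumes "m \<ge> 1"
    and "(1 / 2 ^ s) *\<^sub>R A \<in> Omega m"
    and "(1 / 2 ^ s) *\<^sub>R B \<in> Omega m"
    and "E \<noteq> 0"
    and "is_vector_norm N\<^sub>n" and "is_vector_norm N\<^sub>d"
  shows "ennreal (induced_norm N\<^sub>d N\<^sub>n
                    (D_op (g_fun m) (ball 0 (pade_mu m)) ((1 / 2 ^ s) *\<^sub>R A) ((1 / 2 ^ s) *\<^sub>R B) E)
                  / induced_norm N\<^sub>d N\<^sub>n E)
         \<le> g_tilde_deriv m (1 / 2 ^ s * max (induced_norm N\<^sub>n N\<^sub>n A) (induced_norm N\<^sub>d N\<^sub>d B))"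
proof -
  define c :: real where "c = 1 / 2 ^ s"
  define x where "x = c * max (induced_norm N\<^sub>n N\<^sub>n A) (induced_norm N\<^sub>d N\<^sub>d B)"
  let ?t = "\<lambda>k. real (2 * (m + k) + 1) * cmod (b_coeff m k) * x ^ (2 * (m + k))"
  let ?D = "D_op (g_fun m) (ball 0 (pade_mu m)) (c *\<^sub>R A) (c *\<^sub>R B) E"
  have c: "c > 0"
    by (simp add: c_def)
  have x: "x \<ge> 0"
    using c induced_norm_nonneg[OF assms(5,5), of A] by (simp add: x_def)
  have t: "?t k \<ge> 0" for k
    using x by simp
  have A: "N\<^sub>n ((c *\<^sub>R A) *v v) \<le> x * N\<^sub>n v" for v
    unfolding x_def using c by (intro scaleR_induced_norm_bound assms(5)) auto
  have B: "N\<^sub>d ((c *\<^sub>R B) *v v) \<le> x * N\<^sub>d v" for v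
    unfolding x_def using c by (intro scaleR_induced_norm_bound assms(6)) auto
  have "ennreal (induced_norm N\<^sub>d N\<^sub>n ?D / induced_norm N\<^sub>d N\<^sub>n E) \<le> (\<Sum>k. ennreal (?t k))"
  proof (cases "(\<Sum>k. ennreal (?t k)) = top")
    \<comment> \<open>A divergent series makes the right-hand side infinite, so only the convergent
      case has content; nonnegativity of the terms then gives real summability.\<close>
    case False
    then have sm: "summable ?t"
      using t by (intro summable_suminf_not_top) auto
    have e: "induced_norm N\<^sub>d N\<^sub>n E \<ge> 0"
      by (rule induced_norm_nonneg[OF assms(6,5)])
    have "induced_norm N\<^sub>d N\<^sub>n ?D \<le> suminf ?t * induced_norm N\<^sub>d N\<^sub>n E"
    proof (rule induced_norm_least[OF assms(6)])
      show "N\<^sub>n (?D *v v) \<le> suminf ?t * induced_norm N\<^sub>d N\<^sub>n E * N\<^sub>d v" for v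
      proof (rule vector_norm_D_op_le[OF assms(1) _ _ assms(5,6) A B _ x e sm])
        show "spec_radius (c *\<^sub>R A) < pade_mu m" "spec_radius (c *\<^sub>R B) < pade_mu m"
          using assms(2,3) by (simp_all add: Omega_def c_def)
        show "N\<^sub>n (E *v v) \<le> induced_norm N\<^sub>d N\<^sub>n E * N\<^sub>d v" for v
          by (rule induced_norm_bound[OF assms(6,5)])
      qed
      show "suminf ?t * induced_norm N\<^sub>d N\<^sub>n E \<ge> 0"
        using e suminf_nonneg[OF sm t] by simp
    qed
    then have "induced_norm N\<^sub>d N\<^sub>n ?D / induced_norm N\<^sub>d N\<^sub>n E \<le> suminf ?t"
      \<comment> \<open>With denominator 0 the quotient is 0 by convention, which a nonnegative sum
        dominates.\<close>
      using e suminf_nonneg[OF sm t] by (cases "induced_norm N\<^sub>d N\<^sub>n E = 0") (simp_all add: divide_le_eq)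
    then have "ennreal (induced_norm N\<^sub>d N\<^sub>n ?D / induced_norm N\<^sub>d N\<^sub>n E) \<le> ennreal (suminf ?t)"
      by (rule ennreal_leI)
    also have "\<dots> = (\<Sum>k. ennreal (?t k))"
      using t sm by (intro suminf_ennreal2[symmetric]) auto
    finally show ?thesis .
  qed simp
  then show ?thesis
    by (simp only: g_tilde_deriv_def x_def c_def)
qed

end
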